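(* No quiver in the mutation class of $E_7^{(1,1)}$ has an admissible vector.
   Context: $E_7^{(1,1)}$ is the exceptional mutation-finite quiver (in the classification of Felikson–Shapiro–Tumarkin / Derksen–Owen) given by: vertices $a,b$ with a double arrow $a\Rightarrow b$; three vertices $x_1,x_2,x_3$, each with arrows $b\to x_i$ and $x_i\to a$; and pendant paths (single arrows, any orientation) attached at the $x_i$ so that the three "legs" starting at $x_1,x_2,x_3$ have $3,1,3$ vertices respectively (9 vertices in total). Quivers have no loops/2-cycles; $b_{ij}$ is the number of arrows $v_i\to v_j$ (negative if reversed); mutation $\mu_k$: $b'_{ij}=-b_{ij}$ if $k\in\{i,j\}$, else $b'_{ij}=b_{ij}+\mathrm{sgn}(b_{ik})[b_{ik}b_{kj}]_+$. For a quiver $Q$ on mutable vertices $v_1,\dots,v_n$ and $\boldsymbol b\in\mathbb Z^n$, add a frozen vertex $q$ with $b_i$ arrows from $v_i$ to $q$; mutations only at mutable vertices. $\boldsymbol b$ is admissible if $\boldsymbol b\neq0$ and the resulting quiver with frozen vertex has finite mutation class. *)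

theory Defs
  imports Main
begin

text \<open>A quiver without loops and 2-cycles is given by its signed adjacency matrix:
  \<open>Q u v\<close> is the number of arrows from \<open>u\<close> to \<open>v\<close>, negative if the arrows go from \<open>v\<close> to \<open>u\<close>.\<close>

type_synonym 'v quiver = "'v \<Rightarrow> 'v \<Rightarrow> int"

definition quiver_of_arrows :: "('v \<times> 'v) list \<Rightarrow> 'v quiver" where
  "quiver_of_arrows es =
     (\<lambda>u v. int (count_list es (u, v)) - int (count_list es (v, u)))"

definition mutate :: "'v \<Rightarrow> 'v quiver \<Rightarrow> 'v quiver" where
  "mutate k Q = (\<lambda>i j. if i = k \<or> j = k then - Q i j
                        else Q i j + sgn (Q i k) * max 0 (Q i k * Q k j))"

text \<open>The set \<open>M\<close> consists of the mutable vertices. Quivers are labelled; over a finite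
  vertex set the labelled class is finite iff there are finitely many isomorphism types.\<close>

inductive_set mutation_class :: "'v set \<Rightarrow> 'v quiver \<Rightarrow> 'v quiver set"
  for M :: "'v set" and Q :: "'v quiver" where
  base: "Q \<in> mutation_class M Q"
| step: "Q' \<in> mutation_class M Q \<Longrightarrow> k \<in> M \<Longrightarrow> mutate k Q' \<in> mutation_class M Q"

text \<open>In \<open>add_frozen Q b\<close> the vertex \<open>None\<close> is the frozen vertex.\<close>

fun add_frozen :: "'v quiver \<Rightarrow> ('v \<Rightarrow> int) \<Rightarrow> 'v option quiver" where
  "add_frozen Q b (Some i) (Some j) = Q i j"
| "add_frozen Q b (Some i) None = b i"
| "add_frozen Q b None (Some j) = - b j"
| "add_frozen Q b None None = 0"

definition admissible :: "('v::finite) quiver \<Rightarrow> ('v \<Rightarrow> int) \<Rightarrow> bool" where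
  "admissible Q b \<longleftrightarrow>
     b \<noteq> (\<lambda>_. 0) \<and> finite (mutation_class (range Some) (add_frozen Q b))"

text \<open>The legs are \<open>x1 - y1 - z1\<close>, \<open>x2\<close> and \<open>x3 - y3 - z3\<close>; the arrows \<open>e1\<close>, \<dots>, \<open>e4\<close>
  along the legs are oriented arbitrarily. The labelling of the nine vertices is arbitrary,
  so the predicate is invariant under isomorphism.\<close>

definition is_E7_11 :: "'v quiver \<Rightarrow> bool" where
  "is_E7_11 Q \<longleftrightarrow>
     (\<exists>a b x1 x2 x3 y1 z1 y3 z3 e1 e2 e3 e4.
        distinct [a, b, x1, x2, x3, y1, z1, y3, z3] \<and>
        UNIV = {a, b, x1, x2, x3, y1, z1, y3, z3} \<and>
        e1 \<in> {(x1, y1), (y1, x1)} \<and> e2 \<in> {(y1, z1), (z1, y1)} \<and>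
        e3 \<in> {(x3, y3), (y3, x3)} \<and> e4 \<in> {(y3, z3), (z3, y3)} \<and>
        Q = quiver_of_arrows
              [(a, b), (a, b),
               (b, x1), (x1, a), (b, x2), (x2, a), (b, x3), (x3, a),
               e1, e2, e3, e4])"

end

theory Submission imports Defs begin

text \<open>If a quiver with a frozen vertex has finite mutation class, then the frozen multiplicities at
  the ends of a double arrow \<open>u \<Rightarrow> v\<close> satisfy \<open>b u = - b v \<le> 0\<close>: otherwise mutating alternately at
  \<open>u\<close> and \<open>v\<close> makes them grow without bound. For E7(1,1) two such constraints suffice. One comes
  from the double arrow \<open>a \<Rightarrow> b\<close>; the other from a double arrow that appears after mutating at
  \<open>x1, x2, x3, y1, b, a, z1, y3, b, x2, y1\<close>. The
  multiplicity at the source of the second double arrow is then a sum of nonnegative terms, so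
  all of these vanish, and this forces every frozen multiplicity to be zero.\<close>

definition skew :: "'v quiver \<Rightarrow> bool" where
  "skew Q \<longleftrightarrow> (\<forall>i j. Q i j = - Q j i)"

lemma skewD: "skew Q \<Longrightarrow> Q i j = - Q j i"
  unfolding skew_def by blast

lemma skew_self: "skew Q \<Longrightarrow> Q k k = 0"
  by (metis skewD equal_neg_zero)

lemma skew_quiver_of_arrows: "skew (quiver_of_arrows es)"
  by (simp add: skew_def quiver_of_arrows_def)

text \<open>Both terms vanish unless \<open>p\<close> and \<open>q\<close> have the same sign, and
  then \<open>sgn (- q) = - sgn p\<close>. With \<open>p = Q i k\<close> and
  \<open>q = Q k j\<close> this is the skew-symmetry of the correction term of mutation.\<close>

lemma mutation_term_antisym:
  fixes p q :: int
  shows "sgn p * max 0 (p * q) = - (sgn (- q) * max 0 (- q * - p))"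
proof (cases "p * q > 0")
  case True
  then show ?thesis by (auto simp: zero_less_mult_iff mult.commute)
next
  case False
  then show ?thesis by (simp add: mult.commute)
qed

lemma skew_mutate:
  assumes "skew Q" shows "skew (mutate k Q)"
  unfolding skew_def
proof (intro allI)
  fix i j
  have "sgn (Q i k) * max 0 (Q i k * Q k j) = - (sgn (Q j k) * max 0 (Q j k * Q k i))"
    using mutation_term_antisym[of "Q i k" "Q k j"] skewD[OF assms, of j k] skewD[OF assms, of k i]
    by metis
  then show "mutate k Q i j = - mutate k Q j i"
    using skewD[OF assms, of i j] by (simp add: mutate_def)
qed

lemma mutate_mutate: "mutate k (mutate k Q) = Q"
proof (intro ext)
  fix i j
  have "(- sgn (Q i k)) * max 0 ((- Q i k) * (- Q k j)) = - (sgn (Q i k) * max 0 (Q i k * Q k j))"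
    by simp
  then show "mutate k (mutate k Q) i j = Q i j"
    by (simp add: mutate_def)
qed

definition mutate_vec :: "'v \<Rightarrow> 'v quiver \<Rightarrow> ('v \<Rightarrow> int) \<Rightarrow> 'v \<Rightarrow> int" where
  "mutate_vec k Q b = (\<lambda>i. if i = k then - b k else b i + sgn (Q i k) * max 0 (Q i k * b k))"

text \<open>The parts get names so that later arithmetic treats them as atoms instead of splitting
  on signs.\<close>

definition pos :: "int \<Rightarrow> int" where "pos x = max 0 x"

definition neg :: "int \<Rightarrow> int" where "neg x = max 0 (- x)"

text \<open>In a concrete quiver the sign of \<open>Q i k\<close> is known, so a mutation is linear
  in \<open>b\<close>, \<open>pos (b k)\<close> and \<open>neg (b k)\<close>, with no case split on
  the sign of \<open>b k\<close>.\<close>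

lemma mutate_vec_pos_neg:
  "mutate_vec k Q b i =
     (if i = k then - b k else b i + Q i k * (if Q i k \<ge> 0 then pos (b k) else neg (b k)))"
proof -
  have "sgn s * max 0 (s * c) = s * (if s \<ge> 0 then pos c else neg c)" for s c :: int
    by (cases "c \<ge> 0"; cases "s = 0")
      (auto simp: pos_def neg_def sgn_if max_def zero_le_mult_iff mult_le_0_iff)
  then show ?thesis by (simp add: mutate_vec_def)
qed

lemma mutate_add_frozen:
  assumes "skew Q"
  shows "mutate (Some k) (add_frozen Q b) = add_frozen (mutate k Q) (mutate_vec k Q b)"
proof (intro ext)
  fix x y
  have "sgn (- b k) * max 0 (- b k * Q k j) = - (sgn (Q j k) * max 0 (Q j k * b k))" for j
    using mutation_term_antisym[of "- b k" "Q k j"] skewD[OF assms, of j k] by simp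
  moreover have "max 0 (- b k * b k) = 0" using zero_le_square[of "b k"] by simp
  ultimately show "mutate (Some k) (add_frozen Q b) x y
      = add_frozen (mutate k Q) (mutate_vec k Q b) x y"
    by (cases x; cases y) (auto simp: mutate_def mutate_vec_def)
qed

lemma mutation_class_mutate_subset:
  assumes "k \<in> M" shows "mutation_class M (mutate k Q) \<subseteq> mutation_class M Q"
proof
  fix R assume "R \<in> mutation_class M (mutate k Q)"
  then show "R \<in> mutation_class M Q"
    by induction (auto intro: mutation_class.intros assms)
qed

definition finite_frozen :: "'v quiver \<Rightarrow> ('v \<Rightarrow> int) \<Rightarrow> bool" where
  "finite_frozen Q b \<longleftrightarrow> finite (mutation_class (range Some) (add_frozen Q b))"

lemma finite_frozen_mutate:
  assumes "skew Q" "finite_frozen Q b"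
  shows "finite_frozen (mutate k Q) (mutate_vec k Q b)"
  using assms mutation_class_mutate_subset[of "Some k" "range Some" "add_frozen Q b"]
  by (auto simp: finite_frozen_def mutate_add_frozen intro: finite_subset)

subsection \<open>Double arrows\<close>

text \<open>Alternately mutating at the ends of a double arrow acts on the two frozen multiplicities
  by a shear preserving their sum; the sign \<open>e\<close> covers both directions of the iteration.\<close>

lemma double_arrow_growth:
  assumes "skew Q" "e \<in> {1, -1}" "Q u v = 2 * e" "e * b u < 0" "e * (b u + b v) < 0"
  shows "\<exists>R \<in> mutation_class (range Some) (add_frozen Q b). \<exists>w \<in> {u, v}.
           e * R (Some w) None \<le> e * b u - int n"
  using assms
proof (induction n arbitrary: Q b u v)
  case 0
  then show ?case by (intro bexI[of _ "add_frozen Q b"]) (auto intro: mutation_class.base)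
next
  case (Suc n)
  let ?Q = "mutate u Q" and ?b = "mutate_vec u Q b"
  have uv: "u \<noteq> v" using Suc.prems skew_self[of Q u] by auto
  have vu: "Q v u = - 2 * e" using Suc.prems skewD[of Q v u] by simp
  have b: "?b v = b v + 2 * b u" "?b u = - b u"
    using uv vu Suc.prems(2,4) by (auto simp: mutate_vec_def)
  \<comment> \<open>The mutation reverses the double arrow, so the induction hypothesis applies with
    \<open>u\<close> and \<open>v\<close> exchanged.\<close>
  have "\<exists>R \<in> mutation_class (range Some) (add_frozen ?Q ?b). \<exists>w \<in> {v, u}.
           e * R (Some w) None \<le> e * ?b v - int n"
  proof (rule Suc.IH)
    show "skew ?Q" by (rule skew_mutate) fact
    show "?Q v u = 2 * e" using vu by (simp add: mutate_def)
    show "e * ?b v < 0" "e * (?b v + ?b u) < 0"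
      using Suc.prems(2,4,5) b by (auto simp: algebra_simps)
    show "e \<in> {1, -1}" by fact
  qed
  then obtain R w where R: "R \<in> mutation_class (range Some) (add_frozen ?Q ?b)" "w \<in> {v, u}"
      "e * R (Some w) None \<le> e * ?b v - int n" by auto
  have "R \<in> mutation_class (range Some) (add_frozen Q b)"
    using R(1) mutation_class_mutate_subset[of "Some u" "range Some" "add_frozen Q b"] Suc.prems(1)
    by (auto simp: mutate_add_frozen)
  \<comment> \<open>\<open>e * ?b v\<close> equals \<open>e * b u + e * (b u + b v)\<close>, whose
    second summand is a negative integer: each round loses at least 1.\<close>
  moreover have "e * ?b v - int n \<le> e * b u - int (Suc n)"
    using Suc.prems(2,5) b by (auto simp: algebra_simps)
  ultimately show ?case
    using R(2,3) by (intro bexI[of _ R] bexI[of _ w]) auto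
qed

text \<open>A finite class would bound the values \<open>e * R (Some w) None\<close> from below,
  against their unbounded decrease.\<close>

lemma double_arrow_growth_infinite:
  assumes "skew Q" "e \<in> {1, -1}" "Q u v = 2 * e" "e * b u < 0" "e * (b u + b v) < 0"
  shows "\<not> finite_frozen Q b"
proof
  assume fin: "finite_frozen Q b"
  let ?X = "(\<lambda>(R, w). e * R (Some w) None) `
    (mutation_class (range Some) (add_frozen Q b) \<times> {u, v})"
  have "finite ?X" using fin by (auto simp: finite_frozen_def)
  then obtain m where m: "\<forall>x \<in> ?X. m \<le> x" by (meson Min_le)
  have "e * b u - int (nat (e * b u - m + 1)) < m" by linarith
  then show False using double_arrow_growth[OF assms, of "nat (e * b u - m + 1)"] m by force
qed

text \<open>With these signs, mutating at \<open>u\<close> keeps \<open>b v\<close> and negates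
  \<open>b u\<close>, which gives the hypotheses of the growth lemma for the pair \<open>v\<close>,
  \<open>u\<close>.\<close>

lemma double_arrow_swap_infinite:
  assumes "skew Q" "e \<in> {1, -1}" "Q u v = 2 * e" "e * b u \<ge> 0" "e * b v < 0"
  shows "\<not> finite_frozen Q b"
proof
  assume fin: "finite_frozen Q b"
  let ?Q = "mutate u Q" and ?b = "mutate_vec u Q b"
  have uv: "u \<noteq> v" using assms skew_self[of Q u] by auto
  have vu: "Q v u = - 2 * e" using assms skewD[of Q v u] by simp
  have b: "?b v = b v" "?b u = - b u"
    using uv vu assms(2,4) by (auto simp: mutate_vec_def)
  have "\<not> finite_frozen ?Q ?b"
  proof (rule double_arrow_growth_infinite)
    show "?Q v u = 2 * e" using vu by (simp add: mutate_def)
    show "e * ?b v < 0" "e * (?b v + ?b u) < 0"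
      using assms(2,4,5) b by (auto simp: algebra_simps)
  qed (use assms skew_mutate in auto)
  then show False using finite_frozen_mutate[OF assms(1) fin] by blast
qed

text \<open>Growth and swap, each for both signs of \<open>e\<close>, exclude four regions of the
  plane; only a ray remains.\<close>

lemma double_arrow_constraint:
  assumes "skew Q" "Q u v = 2" "finite_frozen Q b"
  shows "b u + b v = 0 \<and> b v \<ge> 0"
proof -
  have vu: "Q v u = -2" using assms skewD[of Q v u] by simp
  have "\<not> (b u < 0 \<and> b u + b v < 0)"
    using double_arrow_growth_infinite[of Q 1 u v b] assms by auto
  moreover have "\<not> (b v > 0 \<and> b u + b v > 0)"
    using double_arrow_growth_infinite[of Q "-1" v u b] assms vu by auto
  moreover have "\<not> (b u \<ge> 0 \<and> b v < 0)"
    using double_arrow_swap_infinite[of Q 1 u v b] assms by auto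
  moreover have "\<not> (b v \<le> 0 \<and> b u > 0)"
    using double_arrow_swap_infinite[of Q "-1" v u b] assms vu by auto
  ultimately show ?thesis by linarith
qed

subsection \<open>Mutation invariance\<close>

definition no_admissible :: "'v quiver \<Rightarrow> bool" where
  "no_admissible Q \<longleftrightarrow> (\<forall>b. finite_frozen Q b \<longrightarrow> b = (\<lambda>_. 0))"

text \<open>If the mutated vector is zero then \<open>b k = 0\<close>, so all correction terms
  vanish too.\<close>

lemma no_admissible_mutateD:
  assumes "skew Q" "no_admissible (mutate k Q)"
  shows "no_admissible Q"
  unfolding no_admissible_def
proof (intro allI impI)
  fix b assume "finite_frozen Q b"
  from assms(2)[unfolded no_admissible_def, rule_format, OF finite_frozen_mutate[OF assms(1) this]]
  have 0: "mutate_vec k Q b = (\<lambda>_. 0)" .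
  have bk: "b k = 0" using fun_cong[OF 0, of k] by (simp add: mutate_vec_def)
  have "b i = 0" for i using fun_cong[OF 0, of i] bk by (simp add: mutate_vec_def split: if_splits)
  then show "b = (\<lambda>_. 0)" by auto
qed

text \<open>\<open>no_admissible_mutateD\<close> transfers against the direction of mutation;
  involutivity turns it around.\<close>

lemma no_admissible_mutation_class:
  assumes "skew E" "no_admissible E" "Q \<in> mutation_class M E"
  shows "no_admissible Q"
proof -
  from assms(3) have "skew Q \<and> no_admissible Q"
  proof induction
    case base
    then show ?case using assms by simp
  next
    case (step Q' k)
    then show ?case
      by (metis mutate_mutate no_admissible_mutateD skew_mutate)
  qed
  then show ?thesis ..
qed

subsection \<open>Quivers with numbered vertices\<close>

text \<open>Positions in \<open>vs\<close> number the vertices, so that mutations over an abstract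
  vertex type become computations with lists of numbers. Skew-symmetry is demanded separately
  because \<open>vs\<close> need not exhaust the type.\<close>

definition represents :: "'v list \<Rightarrow> (nat \<times> nat) list \<Rightarrow> 'v quiver \<Rightarrow> bool" where
  "represents vs es Q \<longleftrightarrow> skew Q \<and>
     (\<forall>i < length vs. \<forall>j < length vs. Q (vs ! i) (vs ! j) = quiver_of_arrows es i j)"

definition mutates_to :: "nat \<Rightarrow> nat \<Rightarrow> (nat \<times> nat) list \<Rightarrow> (nat \<times> nat) list \<Rightarrow> bool" where
  "mutates_to n k es es' \<longleftrightarrow> k < n \<and>
     (\<forall>i < n. \<forall>j < n. mutate k (quiver_of_arrows es) i j = quiver_of_arrows es' i j)"

lemma represents_mutate:
  assumes "distinct vs" "represents vs es Q" "mutates_to (length vs) k es es'"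
  shows "represents vs es' (mutate (vs ! k) Q)"
proof -
  have "mutate (vs ! k) Q (vs ! i) (vs ! j) = quiver_of_arrows es' i j"
    if "i < length vs" "j < length vs" for i j
  proof -
    have "mutate (vs ! k) Q (vs ! i) (vs ! j) = mutate k (quiver_of_arrows es) i j"
      using assms that unfolding mutate_def
      by (simp add: represents_def mutates_to_def nth_eq_iff_index_eq)
    then show ?thesis using assms that by (simp add: mutates_to_def)
  qed
  then show ?thesis using assms skew_mutate by (auto simp: represents_def)
qed

lemma count_list_map_inj_on:
  assumes "inj_on f (insert x (set xs))"
  shows "count_list (map f xs) (f x) = count_list xs x"
  using assms by (induction xs) (auto simp: inj_on_def)

lemma represents_quiver_of_arrows:
  assumes "distinct vs" "\<forall>(i, j) \<in> set es. i < length vs \<and> j < length vs"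
  shows "represents vs es (quiver_of_arrows (map (\<lambda>(i, j). (vs ! i, vs ! j)) es))"
proof -
  let ?f = "\<lambda>(i, j). (vs ! i, vs ! j)"
  have "count_list (map ?f es) (vs ! i, vs ! j) = count_list es (i, j)"
    if "i < length vs" "j < length vs" for i j
  proof -
    have "inj_on ?f (insert (i, j) (set es))"
    proof (rule inj_on_subset)
      show "inj_on ?f ({..<length vs} \<times> {..<length vs})"
        using assms(1) by (auto simp: inj_on_def nth_eq_iff_index_eq)
      show "insert (i, j) (set es) \<subseteq> {..<length vs} \<times> {..<length vs}"
        using assms(2) that by auto
    qed
    from count_list_map_inj_on[OF this] show ?thesis by simp
  qed
  then show ?thesis
    by (simp add: represents_def skew_quiver_of_arrows) (simp add: quiver_of_arrows_def)
qed

text \<open>With \<open>Q\<close> and \<open>b\<close> hidden by the quantifier, only concrete lists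
  are carried along a chain of mutations.\<close>

definition finite_arrows :: "'v list \<Rightarrow> (nat \<times> nat) list \<Rightarrow> int list \<Rightarrow> bool" where
  "finite_arrows vs es c \<longleftrightarrow> (\<exists>Q b. represents vs es Q \<and> finite_frozen Q b \<and> c = map b vs)"

definition mutate_list :: "nat \<Rightarrow> (nat \<times> nat) list \<Rightarrow> int list \<Rightarrow> int list" where
  "mutate_list k es c = map (mutate_vec k (quiver_of_arrows es) ((!) c)) [0..<length c]"

lemma finite_arrows_mutate:
  assumes "distinct vs" "finite_arrows vs es c" "mutates_to (length vs) k es es'"
  shows "finite_arrows vs es' (mutate_list k es c)"
proof -
  obtain Q b where Q: "represents vs es Q" "finite_frozen Q b" "c = map b vs"
    using assms by (auto simp: finite_arrows_def)
  have k: "k < length vs" using assms by (simp add: mutates_to_def)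
  have "mutate_list k es c = map (mutate_vec (vs ! k) Q b) vs"
    using Q assms(1) k
    by (intro nth_equalityI)
      (auto simp: mutate_list_def mutate_vec_def represents_def nth_eq_iff_index_eq)
  moreover have "finite_frozen (mutate (vs ! k) Q) (mutate_vec (vs ! k) Q b)"
    using Q by (auto simp: represents_def intro: finite_frozen_mutate)
  ultimately show ?thesis
    using represents_mutate[OF assms(1) Q(1) assms(3)] by (auto simp: finite_arrows_def)
qed

lemma finite_arrows_double:
  assumes "finite_arrows vs es c" "quiver_of_arrows es u v = 2" "u < length vs" "v < length vs"
  shows "c ! u + c ! v = 0 \<and> c ! v \<ge> 0"
proof -
  obtain Q b where Q: "represents vs es Q" "finite_frozen Q b" "c = map b vs"
    using assms by (auto simp: finite_arrows_def)
  then show ?thesis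
    using double_arrow_constraint[of Q "vs ! u" "vs ! v" b] assms by (auto simp: represents_def)
qed

definition no_admissible_arrows :: "'v list \<Rightarrow> (nat \<times> nat) list \<Rightarrow> bool" where
  "no_admissible_arrows vs es \<longleftrightarrow> (\<forall>Q. represents vs es Q \<longrightarrow> no_admissible Q)"

lemma no_admissible_arrows_mutateD:
  assumes "distinct vs" "no_admissible_arrows vs es'" "mutates_to (length vs) k es es'"
  shows "no_admissible_arrows vs es"
  unfolding no_admissible_arrows_def
proof (intro allI impI)
  fix Q assume Q: "represents vs es Q"
  then have "no_admissible (mutate (vs ! k) Q)"
    using represents_mutate[OF assms(1) Q assms(3)] assms(2) by (simp add: no_admissible_arrows_def)
  then show "no_admissible Q"
    using Q no_admissible_mutateD by (auto simp: represents_def)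
qed

subsection \<open>The quiver of type E7(1,1)\<close>

text \<open>The vertices \<open>a, b, x1, x2, x3, y1, z1, y3, z3\<close> are numbered \<open>0, \<dots>, 8\<close>.\<close>

definition E7_arrows :: "bool \<Rightarrow> bool \<Rightarrow> bool \<Rightarrow> bool \<Rightarrow> (nat \<times> nat) list" where
  "E7_arrows p q r s =
     [(0, 1), (0, 1), (1, 2), (2, 0), (1, 3), (3, 0), (1, 4), (4, 0),
      if p then (2, 5) else (5, 2), if q then (5, 6) else (6, 5),
      if r then (4, 7) else (7, 4), if s then (7, 8) else (8, 7)]"

section \<open>Sinks, sources and the orientation of the legs\<close>

definition reverse_at :: "nat \<Rightarrow> nat \<times> nat \<Rightarrow> nat \<times> nat" where
  "reverse_at k = (\<lambda>(i, j). if i = k \<or> j = k then (j, i) else (i, j))"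

text \<open>\<open>reverse_at k\<close> is an involution on pairs.\<close>

lemma count_list_reverse_at:
  "count_list (map (reverse_at k) es) (i, j) = count_list es (reverse_at k (i, j))"
  by (induction es) (auto simp: reverse_at_def split: if_splits)

text \<open>No directed path of length two passes through a sink or a source, so the correction
  terms vanish.\<close>

lemma mutates_to_sink_source:
  assumes "k < n" "k \<notin> fst ` set es \<or> k \<notin> snd ` set es"
  shows "mutates_to n k es (map (reverse_at k) es)"
proof -
  let ?Q = "quiver_of_arrows es"
  have 0: "count_list es (k, j) = 0" if "k \<notin> fst ` set es" for j
    using that by (force simp: count_list_0_iff)
  have 1: "count_list es (i, k) = 0" if "k \<notin> snd ` set es" for i
    using that by (force simp: count_list_0_iff)
  have "?Q i k * ?Q k j \<le> 0" for i j
    using assms(2) by (auto simp: quiver_of_arrows_def 0 1 mult_nonneg_nonpos mult_nonneg_nonpos2)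
  then have "mutate k ?Q i j = (if i = k \<or> j = k then - ?Q i j else ?Q i j)" for i j
    by (simp add: mutate_def max_absorb1)
  moreover have "quiver_of_arrows (map (reverse_at k) es) i j
      = (if i = k \<or> j = k then - ?Q i j else ?Q i j)" for i j
    unfolding quiver_of_arrows_def count_list_reverse_at by (auto simp: reverse_at_def)
  ultimately show ?thesis using assms(1) by (simp add: mutates_to_def)
qed

text \<open>Mutations at sinks and sources connect all orientations of a leg; \<open>True\<close>
  stands for an arrow pointing away from the double arrow.\<close>

lemma no_admissible_E7_orient:
  assumes "distinct vs" "length vs = 9"
    and "no_admissible_arrows vs (E7_arrows True True True True)"
  shows "no_admissible_arrows vs (E7_arrows p q r s)"
proof -
  have flip: "no_admissible_arrows vs es"
    if "no_admissible_arrows vs (map (reverse_at k) es)" "k < 9"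
      "k \<notin> fst ` set es \<or> k \<notin> snd ` set es" for k es
    using no_admissible_arrows_mutateD[OF assms(1) that(1)] mutates_to_sink_source[of k 9 es]
      that assms(2) by simp
  note defs = E7_arrows_def reverse_at_def
  \<comment> \<open>Vertices 6 and 8 are leaves, hence sinks or sources in every
    orientation.\<close>
  have z1: "no_admissible_arrows vs (E7_arrows p q' r s)"
    if "no_admissible_arrows vs (E7_arrows p q r s)" for p q q' r s
    using flip[of 6 "E7_arrows p q' r s"] that by (cases "q = q'"; cases q) (auto simp: defs)
  have z3: "no_admissible_arrows vs (E7_arrows p q r s')"
    if "no_admissible_arrows vs (E7_arrows p q r s)" for p q r s s'
    using flip[of 8 "E7_arrows p q r s'"] that by (cases "s = s'"; cases s) (auto simp: defs)
  \<comment> \<open>Vertex 5 is a source here; its mutation reverses the inner and the outer arrow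
    together. Vertex 7 plays the same role on the other leg.\<close>
  have y1: "no_admissible_arrows vs (E7_arrows False True r s)"
    if "no_admissible_arrows vs (E7_arrows True False r s)" for r s
    using flip[of 5 "E7_arrows False True r s"] that by (auto simp: defs)
  have y3: "no_admissible_arrows vs (E7_arrows p q False True)"
    if "no_admissible_arrows vs (E7_arrows p q True False)" for p q
    using flip[of 7 "E7_arrows p q False True"] that by (auto simp: defs)
  have leg3: "no_admissible_arrows vs (E7_arrows True True r s)"
    by (cases r) (simp_all only: z3[OF assms(3)] z3[OF y3[OF z3[OF assms(3)]]])
  show ?thesis
    by (cases p) (simp_all only: z1[OF leg3] z1[OF y1[OF z1[OF leg3]]])
qed

text \<open>The word of mutations was found by computer search.\<close>

abbreviation "E7_mut0 \<equiv>
  [(0, 1), (0, 1), (1, 2), (2, 0), (1, 3), (3, 0), (1, 4), (4, 0),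
   (2, 5), (5, 6), (4, 7), (7, 8)]"
abbreviation "E7_mut1 \<equiv>
  [(0, 1), (0, 2), (1, 3), (1, 4), (1, 5), (2, 1), (3, 0), (4, 0), (4, 7), (5, 2), (5, 6),
   (7, 8)]"
abbreviation "E7_mut2 \<equiv>
  [(0, 2), (0, 3), (1, 4), (1, 5), (2, 1), (3, 1), (4, 0), (4, 7), (5, 2), (5, 6), (7, 8)]"
abbreviation "E7_mut3 \<equiv>
  [(0, 2), (0, 3), (0, 4), (1, 0), (1, 5), (1, 7), (2, 1), (3, 1), (4, 1), (5, 2), (5, 6),
   (7, 4), (7, 8)]"
abbreviation "E7_mut4 \<equiv>
  [(0, 2), (0, 3), (0, 4), (1, 0), (1, 6), (1, 7), (2, 5), (3, 1), (4, 1), (5, 1), (6, 5),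
   (7, 4), (7, 8)]"
abbreviation "E7_mut5 \<equiv>
  [(0, 1), (0, 2), (1, 3), (1, 4), (1, 5), (2, 5), (3, 6), (3, 7), (4, 6), (5, 0), (5, 7),
   (6, 1), (7, 1), (7, 8)]"
abbreviation "E7_mut6 \<equiv>
  [(0, 5), (1, 0), (1, 3), (1, 4), (2, 0), (3, 6), (3, 7), (4, 6), (5, 7), (6, 1), (7, 1),
   (7, 8)]"
abbreviation "E7_mut7 \<equiv>
  [(0, 5), (1, 0), (1, 6), (2, 0), (3, 7), (5, 7), (6, 3), (6, 4), (7, 1), (7, 8)]"
abbreviation "E7_mut8 \<equiv>
  [(0, 5), (1, 0), (1, 6), (1, 7), (2, 0), (3, 1), (3, 8), (5, 1), (5, 8), (6, 3), (6, 4),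
   (7, 3), (7, 5), (8, 7)]"
abbreviation "E7_mut9 \<equiv>
  [(0, 1), (1, 3), (1, 5), (2, 0), (3, 0), (3, 8), (5, 6), (5, 8), (6, 1), (6, 4), (7, 1),
   (8, 7)]"
abbreviation "E7_mut10 \<equiv>
  [(0, 3), (1, 5), (1, 8), (2, 0), (3, 1), (5, 6), (5, 8), (6, 1), (6, 4), (7, 1), (8, 3),
   (8, 7)]"
abbreviation "E7_mut11 \<equiv>
  [(0, 3), (1, 8), (1, 8), (2, 0), (3, 1), (5, 1), (6, 4), (6, 5), (7, 1), (8, 3), (8, 5),
   (8, 7)]"

section \<open>Computation along the mutation sequence\<close>

lemma all_less_9:
  "(\<forall>i < 9 :: nat. P i) \<longleftrightarrow> P 0 \<and> P 1 \<and> P 2 \<and> P 3 \<and> P 4 \<and> P 5 \<and> P 6 \<and> P 7 \<and> P 8"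
  by (simp add: numeral_eq_Suc All_less_Suc) blast

lemma E7_mutations:
  "mutates_to 9 2 E7_mut0 E7_mut1"
  "mutates_to 9 3 E7_mut1 E7_mut2"
  "mutates_to 9 4 E7_mut2 E7_mut3"
  "mutates_to 9 5 E7_mut3 E7_mut4"
  "mutates_to 9 1 E7_mut4 E7_mut5"
  "mutates_to 9 0 E7_mut5 E7_mut6"
  "mutates_to 9 6 E7_mut6 E7_mut7"
  "mutates_to 9 7 E7_mut7 E7_mut8"
  "mutates_to 9 1 E7_mut8 E7_mut9"
  "mutates_to 9 3 E7_mut9 E7_mut10"
  "mutates_to 9 5 E7_mut10 E7_mut11"
  by (simp_all add: mutates_to_def mutate_def quiver_of_arrows_def all_less_9)

lemma no_admissible_E7_standard:
  assumes vs: "distinct vs" "length vs = 9" "set vs = UNIV"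
  shows "no_admissible_arrows vs (E7_arrows True True True True)"
  unfolding no_admissible_arrows_def no_admissible_def
proof (intro allI impI)
  fix Q b
  assume Q: "represents vs (E7_arrows True True True True) Q" "finite_frozen Q b"
  have "represents vs E7_mut0 Q"
    using Q(1) by (simp add: E7_arrows_def)
  then have "finite_arrows vs E7_mut0 (map b vs)"
    using Q(2) by (auto simp: finite_arrows_def)
  \<comment> \<open>The names now denote frozen multiplicities; \<open>m\<close> is the one at
    vertex 1, since \<open>b\<close> is the whole vector.\<close>
  moreover obtain a m x1 x2 x3 y1 z1 y3 z3
    where c: "map b vs = [a, m, x1, x2, x3, y1, z1, y3, z3]"
    using vs(2) by (auto simp: numeral_eq_Suc length_Suc_conv)
  ultimately have F0: "finite_arrows vs E7_mut0 [a, m, x1, x2, x3, y1, z1, y3, z3]" by simp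
  have am: "a + m = 0" "m \<ge> 0"
    using finite_arrows_double[OF F0, of 0 1] vs(2) by (simp_all add: quiver_of_arrows_def)
  have step: "finite_arrows vs es' c'"
    if "finite_arrows vs es c" "mutates_to 9 k es es'" "mutate_list k es c = c'" for es es' k c c'
    using finite_arrows_mutate[OF vs(1) that(1), of k es'] that vs(2) by simp
  have upt9: "[0..<9] = [0, 1, 2, 3, 4, 5, 6, 7, 8 :: nat]"
    by (simp add: upt_rec)
  note eval = mutate_list_def mutate_vec_pos_neg quiver_of_arrows_def upt9
  \<comment> \<open>Each of \<open>v1\<close> to \<open>v11\<close> is the multiplicity at the
    vertex about to be mutated, so later entries stay linear in their \<open>pos\<close> and
    \<open>neg\<close> parts.\<close>
  define v1 where "v1 = x1"
  have F1: "finite_arrows vs E7_mut1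
     [a - neg v1, m + pos v1, - v1, x2, x3, y1 - neg v1, z1, y3, z3]"
    by (rule step[OF F0 E7_mutations(1)]) (simp add: eval v1_def)
  define v2 where "v2 = x2"
  have F2: "finite_arrows vs E7_mut2
     [a - neg v1 - neg v2, m + pos v1 + pos v2, - v1, - v2, x3, y1 - neg v1, z1, y3, z3]"
    by (rule step[OF F1 E7_mutations(2)]) (simp add: eval v2_def)
  define v3 where "v3 = x3"
  have F3: "finite_arrows vs E7_mut3
     [a - neg v1 - neg v2 - neg v3, m + pos v1 + pos v2 + pos v3, - v1, - v2, - v3, y1 - neg v1,
      z1, y3 - neg v3, z3]"
    by (rule step[OF F2 E7_mutations(3)]) (simp add: eval v3_def)
  define v4 where "v4 = y1 - neg v1"
  have F4: "finite_arrows vs E7_mut4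
     [a - neg v1 - neg v2 - neg v3, m + pos v1 + pos v2 + pos v3 + pos v4, - v1 - neg v4, - v2,
      - v3, - v4, z1 - neg v4, y3 - neg v3, z3]"
    by (rule step[OF F3 E7_mutations(4)]) (simp add: eval v4_def)
  define v5 where "v5 = m + pos v1 + pos v2 + pos v3 + pos v4"
  have F5: "finite_arrows vs E7_mut5
     [a - neg v1 - neg v2 - neg v3 - neg v5, - v5, - v1 - neg v4, - v2 + pos v5, - v3 + pos v5,
      - v4 + pos v5, z1 - neg v4 - neg v5, y3 - neg v3 - neg v5, z3]"
    by (rule step[OF F4 E7_mutations(5)]) (simp add: eval v5_def)
  define v6 where "v6 = a - neg v1 - neg v2 - neg v3 - neg v5"
  have F6: "finite_arrows vs E7_mut6
     [- v6, - v5 - neg v6, - v1 - neg v4 - neg v6, - v2 + pos v5, - v3 + pos v5,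
      - v4 + pos v5 + pos v6, z1 - neg v4 - neg v5, y3 - neg v3 - neg v5, z3]"
    by (rule step[OF F5 E7_mutations(6)]) (simp add: eval v6_def)
  define v7 where "v7 = z1 - neg v4 - neg v5"
  have F7: "finite_arrows vs E7_mut7
     [- v6, - v5 - neg v6 - neg v7, - v1 - neg v4 - neg v6, - v2 + pos v5 + pos v7,
      - v3 + pos v5 + pos v7, - v4 + pos v5 + pos v6, - v7, y3 - neg v3 - neg v5, z3]"
    by (rule step[OF F6 E7_mutations(7)]) (simp add: eval v7_def)
  define v8 where "v8 = y3 - neg v3 - neg v5"
  have F8: "finite_arrows vs E7_mut8
     [- v6, - v5 - neg v6 - neg v7 - neg v8, - v1 - neg v4 - neg v6,
      - v2 + pos v5 + pos v7 + pos v8, - v3 + pos v5 + pos v7, - v4 + pos v5 + pos v6 + pos v8,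
      - v7, - v8, z3 - neg v8]"
    by (rule step[OF F7 E7_mutations(8)]) (simp add: eval v8_def)
  define v9 where "v9 = - v5 - neg v6 - neg v7 - neg v8"
  have F9: "finite_arrows vs E7_mut9
     [- v6 - neg v9, - v9, - v1 - neg v4 - neg v6, - v2 + pos v5 + pos v7 + pos v8 + pos v9,
      - v3 + pos v5 + pos v7, - v4 + pos v5 + pos v6 + pos v8 + pos v9, - v7 - neg v9,
      - v8 - neg v9, z3 - neg v8]"
    by (rule step[OF F8 E7_mutations(9)]) (simp add: eval v9_def)
  define v10 where "v10 = - v2 + pos v5 + pos v7 + pos v8 + pos v9"
  have F10: "finite_arrows vs E7_mut10
     [- v6 - neg v9 - neg v10, - v9 + pos v10, - v1 - neg v4 - neg v6, - v10,
      - v3 + pos v5 + pos v7, - v4 + pos v5 + pos v6 + pos v8 + pos v9, - v7 - neg v9,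
      - v8 - neg v9, z3 - neg v8 - neg v10]"
    by (rule step[OF F9 E7_mutations(10)]) (simp add: eval v10_def)
  define v11 where "v11 = - v4 + pos v5 + pos v6 + pos v8 + pos v9"
  have F11: "finite_arrows vs E7_mut11
     [- v6 - neg v9 - neg v10, - v9 + pos v10 + pos v11, - v1 - neg v4 - neg v6, - v10,
      - v3 + pos v5 + pos v7, - v11, - v7 - neg v9 - neg v11, - v8 - neg v9,
      z3 - neg v8 - neg v10 - neg v11]"
    by (rule step[OF F10 E7_mutations(11)]) (simp add: eval v11_def)
  \<comment> \<open>\<open>E7_mut11\<close> has a double arrow from 1 to 8.\<close>
  have final: "- v9 + pos v10 + pos v11 \<le> 0"
      "- v9 + pos v10 + pos v11 + (z3 - neg v8 - neg v10 - neg v11) = 0"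
    using finite_arrows_double[OF F11, of 1 8] vs(2) by (simp_all add: quiver_of_arrows_def)
  have nonneg: "pos x \<ge> 0" "neg x \<ge> 0" for x by (simp_all add: pos_def neg_def)
  have decomp: "x = pos x - neg x" for x by (simp add: pos_def neg_def)
  \<comment> \<open>Expanding \<open>v9\<close> and then \<open>v5\<close> turns the entry at vertex
    1 into this sum of nonnegative terms.\<close>
  have "m + pos v1 + pos v2 + pos v3 + pos v4 + neg v6 + neg v7 + neg v8 + pos v10 + pos v11 = 0"
  proof (rule antisym)
    show "m + pos v1 + pos v2 + pos v3 + pos v4 + neg v6 + neg v7 + neg v8 + pos v10 + pos v11 \<le> 0"
      using final(1) v9_def v5_def by linarith
  qed (simp add: nonneg am(2))
  then have f1: "m = 0" "pos v1 = 0" "pos v2 = 0" "pos v3 = 0" "pos v4 = 0"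
      "neg v6 = 0" "neg v7 = 0" "neg v8 = 0" "pos v10 = 0" "pos v11 = 0"
    by (simp_all add: add_nonneg_eq_0_iff nonneg am(2))
  have "v5 = 0" unfolding v5_def f1 by simp
  then have v5: "pos v5 = 0" "neg v5 = 0" by (simp_all add: pos_def neg_def)
  \<comment> \<open>Once one part of a \<open>v\<close> vanishes, its defining equation becomes a
    vanishing sum of nonnegative terms. This is applied to \<open>v6\<close>, then to
    \<open>v11\<close> and \<open>v10\<close>.\<close>
  have "neg v1 + neg v2 + neg v3 + pos v6 = 0"
    using decomp[of v6] v6_def f1 v5 am by linarith
  then have f2: "neg v1 = 0" "neg v2 = 0" "neg v3 = 0" "pos v6 = 0"
    by (simp_all add: add_nonneg_eq_0_iff nonneg)
  have "neg v4 + pos v8 + pos v9 + neg v11 = 0"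
    using decomp[of v4] decomp[of v11] v11_def f1 f2 v5 by linarith
  then have f3: "neg v4 = 0" "pos v8 = 0" "pos v9 = 0" "neg v11 = 0"
    by (simp_all add: add_nonneg_eq_0_iff nonneg)
  have v2: "v2 = 0" using decomp[of v2] f1 f2 by linarith
  have "pos v7 + neg v10 = 0" using decomp[of v10] v10_def v2 f1 f3 v5 by linarith
  then have f4: "pos v7 = 0" "neg v10 = 0" by (simp_all add: add_nonneg_eq_0_iff nonneg)
  have "a = 0" using am f1 by linarith
  moreover have "x1 = 0" using decomp[of v1] v1_def f1 f2 by linarith
  moreover have "x2 = 0" using v2 v2_def by linarith
  moreover have "x3 = 0" using decomp[of v3] v3_def f1 f2 by linarith
  moreover have "y1 = 0" using decomp[of v4] v4_def f1 f2 f3 by linarith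
  moreover have "z1 = 0" using decomp[of v7] v7_def f1 f3 f4 v5 by linarith
  moreover have "y3 = 0" using decomp[of v8] v8_def f1 f2 f3 v5 by linarith
  \<comment> \<open>Vertex 8 is never mutated, so \<open>z3\<close> is recovered from the equation
    of the second double arrow.\<close>
  moreover have "z3 = 0" using final(2) decomp[of v9] v9_def v5_def f1 f3 f4 by linarith
  ultimately have "\<forall>x \<in> set (map b vs). x = 0" using c f1(1) by simp
  then show "b = (\<lambda>_. 0)" using vs(3) by auto
qed

section \<open>Arbitrary labellings and orientations\<close>

lemma no_admissible_E7_11:
  assumes "is_E7_11 E"
  shows "skew E \<and> no_admissible E"
proof -
  obtain a b x1 x2 x3 y1 z1 y3 z3 e1 e2 e3 e4 where
    E: "distinct [a, b, x1, x2, x3, y1, z1, y3, z3]"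
      "UNIV = {a, b, x1, x2, x3, y1, z1, y3, z3}"
      "e1 \<in> {(x1, y1), (y1, x1)}" "e2 \<in> {(y1, z1), (z1, y1)}"
      "e3 \<in> {(x3, y3), (y3, x3)}" "e4 \<in> {(y3, z3), (z3, y3)}"
      "E = quiver_of_arrows [(a, b), (a, b), (b, x1), (x1, a), (b, x2), (x2, a), (b, x3), (x3, a),
               e1, e2, e3, e4]"
    using assms unfolding is_E7_11_def by blast
  let ?vs = "[a, b, x1, x2, x3, y1, z1, y3, z3]"
  \<comment> \<open>The truth values read off the orientation of each leg arrow.\<close>
  let ?es = "E7_arrows (e1 = (x1, y1)) (e2 = (y1, z1)) (e3 = (x3, y3)) (e4 = (y3, z3))"
  have "E = quiver_of_arrows (map (\<lambda>(i, j). (?vs ! i, ?vs ! j)) ?es)"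
    unfolding E(7) E7_arrows_def using E(1,3-6) by (intro arg_cong[of _ _ quiver_of_arrows]) auto
  then have "represents ?vs ?es E"
    using represents_quiver_of_arrows[OF E(1), of ?es] by (simp add: E7_arrows_def)
  moreover have "no_admissible_arrows ?vs ?es"
    using no_admissible_E7_orient[OF E(1) _ no_admissible_E7_standard[OF E(1)]] E(2) by simp
  ultimately show ?thesis by (auto simp: no_admissible_arrows_def represents_def)
qed

theorem theorem5p2:
  fixes E Q :: "('v::finite) quiver"
  assumes "is_E7_11 E"
    and "Q \<in> mutation_class UNIV E"
  shows "\<not> (\<exists>b. admissible Q b)"
  using no_admissible_mutation_class[OF _ _ assms(2)] no_admissible_E7_11[OF assms(1)]
  by (auto simp: admissible_def no_admissible_def finite_frozen_def)

end
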